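(* Let $k\geq 1$ be an integer, let $w \in \{1,2,\dots,k\}^{\mathbb{Z}}$ and let $S \subseteq \mathbb{Z}_{\geq 0}$. Then the $(S,w)$-gap shift $X_w(S)$ is irreducible.
   Context: A word over an alphabet is a finite sequence of letters; $|u|$ denotes the length of the word $u$, and $\epsilon$ is the empty word, with $|\epsilon|=0$. A nonempty word $u$ appears in a bi-infinite sequence $x=(x_i)_{i\in\mathbb{Z}}$ if $u=x_ix_{i+1}\cdots x_j$ for some integers $i\le j$; the empty word is regarded as appearing in every sequence. The $(S,w)$-gap shift is $$X_w(S)=\overline{\{\ldots 0\,u_{-1}\,0\,u_0\,0\,u_1\,0\ldots : u_i \text{ appears in } w,\ |u_i|\in S \text{ for all } i\in\mathbb{Z}\}}\subseteq\{0,1,\dots,k\}^{\mathbb{Z}},$$ i.e. the closure (in the product topology of the discrete topology) of the set of all bi-infinite concatenations, positioned arbitrarily, in which consecutive $0$'s are separated by words $u_i$ appearing in $w$ with $|u_i|\in S$ (the words $u_i$ may be chosen freely and independently). For a shift space $X$, the language $\mathcal{B}(X)$ is the set of all words (of any length $n\ge 0$) appearing in some point of $X$ (so $\mathcal{B}(X)=\emptyset$ if $X=\emptyset$). The shift $X$ is irreducible if for all ordered pairs $(u,u')$ with $u,u'\in\mathcal{B}(X)$ there is some $v\in\mathcal{B}(X)$ such that $uvu'\in\mathcal{B}(X)$. *)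

theory Defs
  imports "HOL-Analysis.Analysis"
begin

definition appears_in :: "'a list \<Rightarrow> (int \<Rightarrow> 'a) \<Rightarrow> bool" where
  "appears_in u x \<longleftrightarrow> u = [] \<or> (\<exists>i j. i \<le> j \<and> u = map x [i..j])"

definition language :: "(int \<Rightarrow> 'a) set \<Rightarrow> 'a list set" where
  "language X = {u. \<exists>x\<in>X. appears_in u x}"

definition irreducible_shift :: "(int \<Rightarrow> 'a) set \<Rightarrow> bool" where
  "irreducible_shift X \<longleftrightarrow>
     (\<forall>u\<in>language X. \<forall>u'\<in>language X. \<exists>v\<in>language X. u @ v @ u' \<in> language X)"

text \<open>
  The sequence \<open>x\<close> is the concatenation \<open>\<dots> 0 (u (-1)) 0 (u 0) 0 (u 1) 0 \<dots>\<close> with the \<open>0\<close> preceding \<open>u i\<close> placed at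
  the coordinate \<open>p i\<close>; the value \<open>p 0\<close> is arbitrary. Each block contains its leading \<open>0\<close>, so the
  equation forces \<open>p i < p (i + 1)\<close>, and the blocks cover all of \<open>\<int>\<close>.
\<close>
definition gap_concatenations :: "nat set \<Rightarrow> (int \<Rightarrow> nat) \<Rightarrow> (int \<Rightarrow> nat) set" where
  "gap_concatenations S w =
     {x. \<exists>(u :: int \<Rightarrow> nat list) (p :: int \<Rightarrow> int).
           (\<forall>i. appears_in (u i) w \<and> length (u i) \<in> S) \<and>
           (\<forall>i. map x [p i..p (i + 1) - 1] = 0 # u i)}"

definition gap_shift :: "nat \<Rightarrow> nat set \<Rightarrow> (int \<Rightarrow> nat) \<Rightarrow> (int \<Rightarrow> nat) set" where
  "gap_shift k S w =
     product_topology (\<lambda>_. discrete_topology {0..k}) UNIV closure_of gap_concatenations S w"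

end

theory Submission
  imports Defs
begin

text \<open>
  A word of the language of the closure already appears in a gap concatenation. Given words \<open>u\<close>, \<open>u'\<close>
  in concatenations \<open>x\<close>, \<open>x'\<close>, cut \<open>x\<close> at the start of a block lying to the right of \<open>u\<close> and continue
  with \<open>x'\<close> from the start of a block lying to the left of \<open>u'\<close>: since the blocks are independent, the
  result is again a gap concatenation, and \<open>v\<close> is the word between \<open>u\<close> and \<open>u'\<close>.
\<close>

text \<open>Admitting \<open>j = i - 1\<close> covers the empty word without a separate case. The
  bound \<open>i \<le> j + 1\<close> still places an empty word between two coordinates, so adjacent
  intervals can be concatenated.\<close>

lemma appears_in_iff: "appears_in u x \<longleftrightarrow> (\<exists>i j. i \<le> j + 1 \<and> u = map x [i..j])"
proof
  assume "appears_in u x"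
  then show "\<exists>i j. i \<le> j + 1 \<and> u = map x [i..j]"
    unfolding appears_in_def
  proof
    assume "u = []"
    then have "(0::int) \<le> -1 + 1 \<and> u = map x [0..-1]" by simp
    then show ?thesis by blast
  next
    assume "\<exists>i j. i \<le> j \<and> u = map x [i..j]"
    then obtain i j where "i \<le> j" "u = map x [i..j]" by blast
    then have "i \<le> j + 1 \<and> u = map x [i..j]" by simp
    then show ?thesis by blast
  qed
next
  assume "\<exists>i j. i \<le> j + 1 \<and> u = map x [i..j]"
  then obtain i j where "u = map x [i..j]" by blast
  then show "appears_in u x"
    unfolding appears_in_def by (cases "i \<le> j") auto
qed

lemma map_upto_shift: "map (\<lambda>t. f (t + c)) [a..b] = map f [a + c..b + c]" for a b c :: int
  by (rule nth_equalityI) (auto simp: nth_upto algebra_simps)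

text \<open>The cylinder that fixes the coordinates in \<open>I\<close> and leaves the others free
  in \<open>A\<close> is an open neighbourhood of \<open>x\<close>, so it meets \<open>G\<close>.
  Any point in it takes values in \<open>A\<close>.\<close>

lemma closure_of_cylinder:
  assumes x: "x \<in> product_topology (\<lambda>_. discrete_topology A) UNIV closure_of G" and "finite I"
  obtains y where "y \<in> G" "range y \<subseteq> A" "\<And>i. i \<in> I \<Longrightarrow> y i = x i"
proof -
  let ?X = "\<lambda>i. if i \<in> I then {x i} else A"
  have xA: "x i \<in> A" for i
    using x by (auto simp: in_closure_of)
  have "finite {i. ?X i \<noteq> topspace (discrete_topology A)}"
    by (rule finite_subset[OF _ \<open>finite I\<close>]) auto
  then have "openin (product_topology (\<lambda>_. discrete_topology A) UNIV) (\<Pi>\<^sub>E i\<in>UNIV. ?X i)"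
    by (intro product_topology_basis) (use xA in auto)
  moreover have "x \<in> (\<Pi>\<^sub>E i\<in>UNIV. ?X i)"
    using xA by auto
  ultimately obtain y where "y \<in> G" and y: "y \<in> (\<Pi>\<^sub>E i\<in>UNIV. ?X i)"
    using x unfolding in_closure_of by blast
  have yX: "y i \<in> ?X i" for i
    using y by (auto simp: PiE_iff)
  have "range y \<subseteq> A"
  proof
    fix z assume "z \<in> range y"
    then obtain i where "z = y i" by blast
    then show "z \<in> A" using yX[of i] xA[of i] by (cases "i \<in> I") auto
  qed
  moreover have "y i = x i" if "i \<in> I" for i
    using yX[of i] that by simp
  ultimately show thesis
    using that \<open>y \<in> G\<close> by blast
qed

text \<open>A word sees only finitely many coordinates, so a point of the closure may be replaced by
  a nearby gap concatenation. The range condition places that point in the full shift over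
  \<open>{0..k}\<close>, in which the closure is taken.\<close>

lemma language_gap_shift_iff:
  "u \<in> language (gap_shift k S w) \<longleftrightarrow>
     (\<exists>x \<in> gap_concatenations S w. range x \<subseteq> {0..k} \<and> appears_in u x)"
proof
  assume "u \<in> language (gap_shift k S w)"
  then obtain x i j where x: "x \<in> gap_shift k S w" and u: "i \<le> j + 1" "u = map x [i..j]"
    unfolding language_def appears_in_iff by blast
  obtain y where "y \<in> gap_concatenations S w" "range y \<subseteq> {0..k}"
    and y: "\<And>t. t \<in> {i..j} \<Longrightarrow> y t = x t"
    using closure_of_cylinder[OF x[unfolded gap_shift_def], of "{i..j}"] by auto
  moreover have "u = map y [i..j]"
    using u y by simp
  ultimately show "\<exists>x \<in> gap_concatenations S w. range x \<subseteq> {0..k} \<and> appears_in u x"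
    unfolding appears_in_iff using u by blast
next
  assume "\<exists>x \<in> gap_concatenations S w. range x \<subseteq> {0..k} \<and> appears_in u x"
  then obtain x where "x \<in> gap_concatenations S w" "range x \<subseteq> {0..k}" "appears_in u x"
    by blast
  moreover have "x \<in> gap_shift k S w"
    unfolding gap_shift_def in_closure_of using calculation by auto
  ultimately show "u \<in> language (gap_shift k S w)"
    unfolding language_def by blast
qed

text \<open>Over the integers each strict increase is at least 1. Hence block starts are unbounded
  in both directions, which provides the cut points for splicing.\<close>

lemma increasing_int_ge:
  fixes p :: "int \<Rightarrow> int"
  assumes "\<And>i. p i < p (i + 1)" and "i \<le> j"
  shows "p i + (j - i) \<le> p j"
  using \<open>i \<le> j\<close>
proof (induction j rule: int_ge_induct)
  case (step j)
  then show ?case using assms(1)[of j] by linarith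
qed simp

lemma gap_concatenations_splice:
  assumes x: "x \<in> gap_concatenations S w" and x': "x' \<in> gap_concatenations S w"
  obtains c c' where "b < c" "c' \<le> a"
    "(\<lambda>t. if t < c then x t else x' (t + (c' - c))) \<in> gap_concatenations S w"
proof -
  obtain u :: "int \<Rightarrow> nat list" and p :: "int \<Rightarrow> int"
    where u: "\<And>i. appears_in (u i) w \<and> length (u i) \<in> S"
    and p: "\<And>i. map x [p i..p (i + 1) - 1] = 0 # u i"
    using x unfolding gap_concatenations_def by blast
  obtain u' :: "int \<Rightarrow> nat list" and p' :: "int \<Rightarrow> int"
    where u': "\<And>i. appears_in (u' i) w \<and> length (u' i) \<in> S"
    and p': "\<And>i. map x' [p' i..p' (i + 1) - 1] = 0 # u' i"
    using x' unfolding gap_concatenations_def by blast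
  \<comment> \<open>Otherwise the interval would be empty, but its image contains the leading
    \<open>0\<close>.\<close>
  have p_less: "p i < p (i + 1)" for i
    using p[of i] by (rule contrapos_pp) simp
  have p'_less: "p' i < p' (i + 1)" for i
    using p'[of i] by (rule contrapos_pp) simp
  \<comment> \<open>Growth by at least 1 per block gives \<open>p n \<ge> p 0 + n > b\<close> and
    \<open>p' m \<le> p' 0 + m \<le> a\<close>. The signs of \<open>n\<close> and \<open>m\<close>
    allow comparison with block 0.\<close>
  define n where "n = max 0 (b + 1 - p 0)"
  define m where "m = min 0 (a - p' 0)"
  have n: "b < p n"
    using increasing_int_ge[of p 0 n, OF p_less] by (auto simp: n_def)
  have m: "p' m \<le> a"
    using increasing_int_ge[of p' m 0, OF p'_less] by (auto simp: m_def)
  define d where "d = p' m - p n"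
  define y where "y = (\<lambda>t. if t < p n then x t else x' (t + d))"
  \<comment> \<open>From index \<open>n\<close> on, the blocks are those of \<open>x'\<close> from
    index \<open>m\<close> on, translated by \<open>- d\<close>. The choice of \<open>d\<close>
    makes \<open>p' m - d = p n\<close>, so the two families of blocks meet without gap or
    overlap.\<close>
  define q where "q i = (if i < n then p i else p' (i + (m - n)) - d)" for i
  define v where "v i = (if i < n then u i else u' (i + (m - n)))" for i
  have "map y [q i..q (i + 1) - 1] = 0 # v i" for i
  proof (cases "i < n")
    case True
    \<comment> \<open>Only \<open>i + 1 = n\<close> needs thought: the last block of
      \<open>x\<close> ends just before the first block taken from \<open>x'\<close>.\<close>
    have "q (i + 1) = p (i + 1)"
    proof (cases "i + 1 < n")
      case False
      with True have "n = i + 1" by simp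
      then show ?thesis by (simp add: q_def d_def)
    qed (simp add: q_def)
    moreover have "p (i + 1) \<le> p n"
      using increasing_int_ge[of p "i + 1" n, OF p_less] True by simp
    ultimately have "map y [q i..q (i + 1) - 1] = map x [p i..p (i + 1) - 1]"
      using True by (auto simp: y_def q_def)
    then show ?thesis
      using p True by (simp add: v_def)
  next
    case False
    define j where "j = i + (m - n)"
    have q: "q i = p' j - d" "q (i + 1) = p' (j + 1) - d"
      using False by (simp_all add: q_def j_def algebra_simps)
    have "p' m \<le> p' j"
      using increasing_int_ge[of p' m j, OF p'_less] False by (simp add: j_def)
    then have "map y [q i..q (i + 1) - 1] = map (\<lambda>t. x' (t + d)) [q i..q (i + 1) - 1]"
      by (auto simp: y_def q d_def)
    also have "\<dots> = map x' [p' j..p' (j + 1) - 1]"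
      unfolding map_upto_shift by (simp add: q)
    finally show ?thesis
      using p' False by (simp add: v_def j_def)
  qed
  moreover have "appears_in (v i) w \<and> length (v i) \<in> S" for i
    using u u' by (simp add: v_def)
  ultimately have "y \<in> gap_concatenations S w"
    unfolding gap_concatenations_def by blast
  then show thesis
    unfolding y_def d_def by (rule that[OF n m])
qed

theorem proposition4p5:
  fixes k :: nat and w :: "int \<Rightarrow> nat" and S :: "nat set"
  assumes "k \<ge> 1"
    and "\<And>i. w i \<in> {1..k}"
  shows "irreducible_shift (gap_shift k S w)"
  unfolding irreducible_shift_def
proof (intro ballI)
  fix u u'
  assume "u \<in> language (gap_shift k S w)" "u' \<in> language (gap_shift k S w)"
  then obtain x x' a b a' b'
    where x: "x \<in> gap_concatenations S w" "range x \<subseteq> {0..k}"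
      and x': "x' \<in> gap_concatenations S w" "range x' \<subseteq> {0..k}"
      and u: "a \<le> b + 1" "u = map x [a..b]" and u': "a' \<le> b' + 1" "u' = map x' [a'..b']"
    unfolding language_gap_shift_iff appears_in_iff by blast
  obtain c c' where c: "b < c" "c' \<le> a'"
    and splice: "(\<lambda>t. if t < c then x t else x' (t + (c' - c))) \<in> gap_concatenations S w"
    using gap_concatenations_splice[OF x(1) x'(1)] by metis
  define d where "d = c' - c"
  define y where "y = (\<lambda>t. if t < c then x t else x' (t + d))"
  define v where "v = map y [b + 1..a' - d - 1]"
  have y: "y \<in> gap_concatenations S w" "range y \<subseteq> {0..k}"
    using splice x(2) x'(2) unfolding y_def d_def by (simp_all add: image_subset_iff)
  \<comment> \<open>The cut lies in between: \<open>b < c \<le> a' - d\<close>. So \<open>u\<close>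
    is read in the part of \<open>y\<close> from \<open>x\<close>, and \<open>u'\<close> in the part
    from \<open>x'\<close>; \<open>v\<close> may be empty.\<close>
  have ba: "b + 1 \<le> a' - d"
    using c by (simp add: d_def)
  have "u = map y [a..b]"
    using u c by (simp add: y_def)
  moreover have "u' = map y [a' - d..b' - d]"
  proof -
    have "map y [a' - d..b' - d] = map (\<lambda>t. x' (t + d)) [a' - d..b' - d]"
      using c by (auto simp: y_def d_def)
    then show ?thesis
      unfolding map_upto_shift using u' by simp
  qed
  moreover have "[a..b] @ [b + 1..a' - d - 1] @ [a' - d..b' - d] = [a..b' - d]"
  proof -
    \<comment> \<open>The left interval may be empty, but then \<open>i = j + 1\<close> exactly, so
      nothing is lost or repeated.\<close>
    have split: "[i..j] @ [j + 1..l] = [i..l]" if "i \<le> j + 1" "j \<le> l" for i j l :: int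
    proof (cases "i \<le> j")
      case False
      with that have "i = j + 1" by simp
      then show ?thesis by simp
    qed (use that upto_split2[of i j l] in simp)
    show ?thesis
      using split[of "b + 1" "a' - d - 1" "b' - d"] split[of a b "b' - d"] u(1) u'(1) ba by simp
  qed
  ultimately have "u @ v @ u' = map y [a..b' - d]"
    unfolding v_def by (metis map_append)
  moreover have "a \<le> b' - d + 1"
    using u(1) u'(1) ba by simp
  ultimately have "appears_in (u @ v @ u') y"
    unfolding appears_in_iff by blast
  moreover have "appears_in v y"
    unfolding appears_in_iff v_def using ba
    by (intro exI[of _ "b + 1"] exI[of _ "a' - d - 1"]) simp
  ultimately have "v \<in> language (gap_shift k S w)" "u @ v @ u' \<in> language (gap_shift k S w)"
    unfolding language_gap_shift_iff using y by auto
  then show "\<exists>v\<in>language (gap_shift k S w). u @ v @ u' \<in> language (gap_shift k S w)"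
    by blast
qed

end
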